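(* Let $p$ be a positive prime integer, let $\epsilon$ be a generator of the cyclic group $\mathbb{U}_p$, let $\mathbb{M}$ be a multiplicative subgroup of $\mathbb{U}_p$ of order $M$, and let $a:=\frac{p-1}{M}$ be the index of $\mathbb{M}$ in $\mathbb{U}_p$. Let $\sigma:\mathbb{Z}_p\to\mathbb{Z}_p$ be the permutation of $\mathbb{Z}_p$ given by $\sigma(0)=0$ and $$\sigma(\ell)=\epsilon^{\lfloor\frac{\ell-1}{M}\rfloor+\left(\ell-\lfloor\frac{\ell-1}{M}\rfloor M-1\right)a}\qquad(\ell\in\{1,\dots,p-1\}),$$ with powers of $\epsilon$ taken modulo $p$. Let $\mathbf{y}\in\mathbb{C}^p$ be a non-zero vector satisfying (i) $\widehat{\mathbf{y}}(0)\neq 0$, and (ii) for each $t\in\{0,\dots,a-1\}$ there exists $r_t\in\{0,\dots,M-1\}$ such that $\widehat{\mathbf{y}}(\epsilon^{r_t a+t})\neq 0$. Put $$R':=\frac{1}{\sqrt{pM}\,|\widehat{\mathbf{y}}(0)|},\qquad R_t:=\frac{1}{\sqrt{\sum_{r=0}^{M-1}p\,|\widehat{\mathbf{y}}(\epsilon^{ra+t})|^2}}\quad(t\in\{0,\dots,a-1\}).$$ Let $\widehat{\mathbf{y}}'\in\mathbb{C}^p$ be defined by $\widehat{\mathbf{y}}'(\ell):=\widehat{\mathbf{y}}(\sigma(\ell))$ for $\ell\in\mathbb{Z}_p$, and let $\widehat{\mathbf{y}}'':=\mathbf{D}(\mathbb{M},\mathbf{y})\,\widehat{\mathbf{y}}'$,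 where $\mathbf{D}(\mathbb{M},\mathbf{y})$ is the $p\times p$ block-diagonal matrix whose successive diagonal blocks are the $1\times 1$ block $[R']$ and the $M\times M$ blocks $R_0 I_M, R_1 I_M,\dots,R_{a-1}I_M$ ($I_M$ the $M\times M$ identity matrix; rows and columns are indexed by $0,1,\dots,p-1$ in this order). Let $\mathbf{y}_\sigma\in\mathbb{C}^p$ be the vector whose discrete Fourier transform $\widehat{\mathbf{y}}_\sigma$ is given by $\widehat{\mathbf{y}}_\sigma(\sigma(\ell)):=\widehat{\mathbf{y}}''(\ell)$ for all $\ell\in\mathbb{Z}_p$. Then the finite wavelet system $\mathcal{W}(\mathbf{y}_\sigma,\Delta_{\mathbb{M}})$, where $\Delta_{\mathbb{M}}:=\mathbb{M}\times\mathbb{Z}_p$, is an equal-norm Parseval frame for $\mathbb{C}^p$.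
   Context: $\mathbb{Z}_p=\{0,\dots,p-1\}$ is the cyclic group (field) of integers modulo $p$, and $\mathbb{U}_p=\mathbb{Z}_p\setminus\{0\}$ is its multiplicative group, which is cyclic of order $p-1$. $\mathbb{C}^p$ is the space of functions $\mathbf{x}:\mathbb{Z}_p\to\mathbb{C}$ with inner product $\langle\mathbf{x},\mathbf{y}\rangle=\sum_{k\in\mathbb{Z}_p}\mathbf{x}(k)\overline{\mathbf{y}(k)}$ and norm $\|\cdot\|_2$. The unitary discrete Fourier transform is $\widehat{\mathbf{x}}(\ell)=\frac{1}{\sqrt p}\sum_{k=0}^{p-1}\mathbf{x}(k)e^{-2\pi i\ell k/p}$, which is a bijection of $\mathbb{C}^p$ onto itself. For $k\in\mathbb{Z}_p$ the translation operator on $\mathbb{C}^p$ is $T_k\mathbf{x}(s)=\mathbf{x}(s-k)$. For $m\in\mathbb{U}_p$ the cyclic dilation operator on $\mathbb{C}^p$ is $D_m\mathbf{x}(k)=\mathbf{x}(m_p k)$, where $m_p$ is the multiplicative inverse of $m$ in $\mathbb{U}_p$. For $\mathbf{y}\in\mathbb{C}^p$ and $\Delta\subseteq\mathbb{U}_p\times\mathbb{Z}_p$, the finite wavelet system is the indexed family $\mathcal{W}(\mathbf{y},\Delta):=\{T_kD_m\mathbf{y}:(m,k)\in\Delta\}$ (vectors counted with multiplicity according to the index $(m,k)$). A finite family $\{\mathbf{y}_j\}_{j}$ in $\mathbb{C}^p$ is a Parseval frame for $\mathbb{C}^p$ if $\sum_j|\langle\mathbf{x},\mathbf{y}_j\rangle|^2=\|\mathbf{x}\|_2^2$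 for all $\mathbf{x}\in\mathbb{C}^p$; it is equal-norm if all $\mathbf{y}_j$ have the same $\|\cdot\|_2$-norm. *)

theory Defs
  imports
    "HOL-Number_Theory.Residues"
    "HOL-Algebra.Generated_Groups"
    "HOL-Analysis.Complex_Transcendental"
    "Jordan_Normal_Form.Matrix"
    "Jordan_Normal_Form.Conjugate"
begin

text \<open>
  The space of functions from the integers modulo \<open>p\<close> to the complex numbers is
  \<^term>\<open>carrier_vec p :: complex vec set\<close>; its inner product is \<open>x \<bullet>c y\<close> (conjugate-linear in
  the second argument). Residues are the integers \<open>0, \<dots>, p - 1\<close> of \<^const>\<open>residue_ring\<close>.
\<close>

abbreviation Zp :: "nat \<Rightarrow> int ring" where
  "Zp p \<equiv> residue_ring (int p)"

abbreviation Up :: "nat \<Rightarrow> int monoid" where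
  "Up p \<equiv> units_of (Zp p)"

text \<open>The argument is reduced modulo the dimension, so integer powers and products can be plugged in
  without reducing them first.\<close>

definition at_res :: "complex vec \<Rightarrow> int \<Rightarrow> complex" where
  "at_res x k = x $ nat (k mod int (dim_vec x))"

definition norm2 :: "complex vec \<Rightarrow> real" where
  "norm2 x = sqrt (\<Sum>k<dim_vec x. (cmod (x $ k))\<^sup>2)"

definition dft :: "complex vec \<Rightarrow> complex vec" where
  "dft x = (let p = dim_vec x in
     vec p (\<lambda>l. 1 / complex_of_real (sqrt (real p)) *
       (\<Sum>k<p. x $ k * exp (- 2 * of_real pi * \<i> * of_nat l * of_nat k / of_nat p))))"

definition translation :: "int \<Rightarrow> complex vec \<Rightarrow> complex vec" where
  "translation k x = vec (dim_vec x) (\<lambda>s. at_res x (int s - k))"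

definition dilation :: "int \<Rightarrow> complex vec \<Rightarrow> complex vec" where
  "dilation m x = vec (dim_vec x) (\<lambda>k. at_res x (inv\<^bsub>Up (dim_vec x)\<^esub> m * int k))"

text \<open>
  The wavelet system of \<open>y\<close> over an index set \<open>\<Delta>\<close> is the family of the vectors
  \<open>wavelet y (m, k)\<close> with \<open>(m, k)\<close> in \<open>\<Delta>\<close>. It is kept as an indexed family, so that vectors
  arising from several indices are counted once for each index.
\<close>

definition wavelet :: "complex vec \<Rightarrow> int \<times> int \<Rightarrow> complex vec" where
  "wavelet y = (\<lambda>(m, k). translation k (dilation m y))"

definition parseval_frame :: "nat \<Rightarrow> 'i set \<Rightarrow> ('i \<Rightarrow> complex vec) \<Rightarrow> bool" where
  "parseval_frame n J f \<longleftrightarrow> finite J \<and> (\<forall>j\<in>J. f j \<in> carrier_vec n) \<and>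
     (\<forall>x\<in>carrier_vec n. (\<Sum>j\<in>J. (cmod (x \<bullet>c f j))\<^sup>2) = (norm2 x)\<^sup>2)"

definition equal_norm :: "'i set \<Rightarrow> ('i \<Rightarrow> complex vec) \<Rightarrow> bool" where
  "equal_norm J f \<longleftrightarrow> (\<forall>i\<in>J. \<forall>j\<in>J. norm2 (f i) = norm2 (f j))"

text \<open>
  The permutation \<open>\<sigma>\<close>, for the generator \<open>e\<close> and a subgroup of order \<open>M\<close> and index \<open>a\<close>.
  The truncated subtractions are exact: the last one is only used for \<open>l \<ge> 1\<close>.
\<close>

definition sigma_perm :: "nat \<Rightarrow> int \<Rightarrow> nat \<Rightarrow> nat \<Rightarrow> nat \<Rightarrow> nat" where
  "sigma_perm p e M a l = (if l = 0 then 0 else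
     nat (e ^ ((l - 1) div M + (l - ((l - 1) div M) * M - 1) * a) mod int p))"

definition R_zero :: "nat \<Rightarrow> nat \<Rightarrow> complex vec \<Rightarrow> real" where
  "R_zero p M y = 1 / (sqrt (real (p * M)) * cmod (dft y $ 0))"

definition R_coset :: "nat \<Rightarrow> int \<Rightarrow> nat \<Rightarrow> nat \<Rightarrow> complex vec \<Rightarrow> nat \<Rightarrow> real" where
  "R_coset p e M a y t =
     1 / sqrt (\<Sum>r<M. real p * (cmod (at_res (dft y) (e ^ (r * a + t))))\<^sup>2)"

definition D_mat :: "nat \<Rightarrow> int \<Rightarrow> nat \<Rightarrow> nat \<Rightarrow> complex vec \<Rightarrow> complex mat" where
  "D_mat p e M a y = diag_block_mat
     (complex_of_real (R_zero p M y) \<cdot>\<^sub>m 1\<^sub>m 1 #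
      map (\<lambda>t. complex_of_real (R_coset p e M a y t) \<cdot>\<^sub>m 1\<^sub>m M) [0..<a])"

end

theory Submission
  imports Defs
begin

text \<open>
  Everything happens on the Fourier side. There, translating by \<open>k\<close> multiplies by a character
  and dilating by \<open>m\<close> moves the value at \<open>m * l\<close> to \<open>l\<close>. Hence, for fixed \<open>m\<close>, the numbers
  \<open>x \<bullet>c wavelet z (m, k)\<close> are, up to the factor \<open>sqrt p\<close>, the inverse Fourier transform in \<open>k\<close> of
  the product of \<open>dft x\<close> with the conjugate of the dilated \<open>dft z\<close>. Plancherel's identity in \<open>k\<close>,
  followed by summation over a set \<open>A\<close> of dilations, turns the sum of all \<open>|x \<bullet>c wavelet z (m, k)|\<^sup>2\<close>
  into \<open>\<Sum>l<p. |dft x $ l|\<^sup>2 * (p * (\<Sum>m\<in>A. |dft z (m * l)|\<^sup>2))\<close>.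
  So the system is a Parseval frame as soon as the discrete Calderon sum
  \<open>p * (\<Sum>m\<in>A. |dft z (m * l)|\<^sup>2)\<close> equals 1 at every frequency \<open>l\<close>
  (\<open>parseval_frame_waveletI\<close>).

  When \<open>A\<close> is a subgroup \<open>H\<close> of order \<open>M\<close> and index \<open>a\<close>, the Calderon sum is constant on the
  orbits of \<open>H\<close> on the residues: the orbit of 0, and the cosets of \<open>H\<close>. As the unit group is
  cyclic with generator \<open>\<epsilon>\<close>, these cosets are the sets \<open>{\<epsilon> ^ (r * a + t) | r < M}\<close> for \<open>t < a\<close>
  (\<open>coset_decomposition_Up\<close>). The permutation \<open>\<sigma>\<close> lists 0 and then these cosets one after the
  other, and the diagonal matrix multiplies each orbit by its own constant. So the passage from \<open>y\<close>
  to \<open>y\<^sub>\<sigma>\<close> rescales the Fourier transform by one constant per orbit, and \<open>R_zero\<close> and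
  \<open>R_coset\<close> are exactly the constants that normalise the Calderon sums to 1; the non-vanishing
  hypotheses make their denominators non-zero. That all vectors have the same norm is
  clear, because translations and dilations permute the coordinates.
\<close>

(* Vectors here are those of varying dimension; $ is their indexing only. *)
unbundle no vec_syntax

section \<open>Additive characters\<close>

definition char_mod :: "nat \<Rightarrow> int \<Rightarrow> complex" where
  "char_mod p k = exp (2 * of_real pi * \<i> * of_int k / of_nat p)"

lemma char_mod_add: "char_mod p (j + k) = char_mod p j * char_mod p k"
  by (simp add: char_mod_def algebra_simps add_divide_distrib flip: exp_add)

lemma char_mod_of_nat_mult: "char_mod p (int k * j) = char_mod p j ^ k"
  by (simp add: char_mod_def algebra_simps flip: exp_of_nat_mult)

lemma cnj_char_mod: "cnj (char_mod p k) = char_mod p (- k)"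
  by (simp add: char_mod_def exp_cnj)

lemma char_mod_eq_1_iff:
  assumes "p > 0"
  shows "char_mod p k = 1 \<longleftrightarrow> int p dvd k"
proof -
  have "char_mod p k = 1 \<longleftrightarrow> (\<exists>n::int. 2 * pi * of_int k / of_nat p = of_int (2 * n) * pi)"
    by (simp add: char_mod_def exp_eq_1)
  also have "\<dots> \<longleftrightarrow> (\<exists>n::int. k = int p * n)"
  proof (rule arg_cong[where f = Ex], rule ext)
    fix n :: int
    have "2 * pi * of_int k / of_nat p = of_int (2 * n) * pi
        \<longleftrightarrow> real_of_int k = real_of_int (int p * n)"
      using assms by (auto simp: field_simps)
    then show "(2 * pi * of_int k / of_nat p = of_int (2 * n) * pi) = (k = int p * n)"
      by (simp only: of_int_eq_iff)
  qed
  finally show ?thesis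
    by (auto simp: dvd_def)
qed

lemma char_mod_cong:
  assumes "p > 0" "[j = k] (mod int p)"
  shows "char_mod p j = char_mod p k"
proof -
  have "char_mod p (j - k) = 1"
    using assms by (simp add: char_mod_eq_1_iff cong_iff_dvd_diff)
  then show ?thesis
    using char_mod_add[of p "j - k" k] by simp
qed

lemma char_mod_mult_mod:
  assumes "p > 0"
  shows "char_mod p (- (l * (s mod int p))) = char_mod p (- (l * s))"
proof -
  have "[l * (s mod int p) = l * s] (mod int p)"
    by (intro cong_scalar_left) (simp add: cong_def)
  then show ?thesis
    by (intro char_mod_cong[OF assms]) (simp add: cong_minus_minus_iff)
qed

text \<open>
  Orthogonality of characters: a geometric sum whose ratio is a \<open>p\<close>-th root of unity.
\<close>

lemma sum_char_mod:
  assumes "p > 0"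
  shows "(\<Sum>k<p. char_mod p (int k * j)) = (if int p dvd j then of_nat p else 0)"
proof (cases "int p dvd j")
  case True
  then show ?thesis
    using char_mod_eq_1_iff[OF assms, of j] by (simp add: char_mod_of_nat_mult)
next
  case False
  then have "char_mod p j \<noteq> 1"
    using assms by (simp add: char_mod_eq_1_iff)
  moreover have "char_mod p j ^ p = 1"
    unfolding char_mod_of_nat_mult[symmetric] using assms by (simp add: char_mod_eq_1_iff)
  ultimately show ?thesis
    using False by (simp add: char_mod_of_nat_mult sum_gp_strict)
qed

text \<open>
  The unit \<open>c\<close> lets the same identity serve for the Fourier transform (\<open>c = -1\<close>) and for its
  inverse (\<open>c = 1\<close>).
\<close>

lemma character_sum_plancherel:
  assumes "p > 0" "coprime c (int p)"
  shows "(\<Sum>l<p. (\<Sum>j<p. f j * char_mod p (c * int l * int j)) *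
           cnj (\<Sum>k<p. g k * char_mod p (c * int l * int k))) =
         of_nat p * (\<Sum>j<p. f j * cnj (g j))"
proof -
  have orth: "(\<Sum>l<p. char_mod p (int l * (c * (int j - int k)))) = (if j = k then of_nat p else 0)"
    if "j < p" "k < p" for j k
  proof -
    have "int p dvd c * (int j - int k) \<longleftrightarrow> [int j = int k] (mod int p)"
      using assms(2) by (simp add: coprime_dvd_mult_right_iff coprime_commute cong_iff_dvd_diff)
    also have "\<dots> \<longleftrightarrow> j = k"
      using that by (simp add: cong_int_iff cong_def)
    finally show ?thesis
      using sum_char_mod[OF assms(1)] by simp
  qed
  have "(\<Sum>l<p. (\<Sum>j<p. f j * char_mod p (c * int l * int j)) *
           cnj (\<Sum>k<p. g k * char_mod p (c * int l * int k))) =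
        (\<Sum>l<p. \<Sum>j<p. \<Sum>k<p. f j * cnj (g k) * char_mod p (int l * (c * (int j - int k))))"
    by (simp add: sum_product cnj_char_mod mult_ac ring_distribs flip: char_mod_add)
  also have "\<dots> = (\<Sum>j<p. \<Sum>l<p. \<Sum>k<p. f j * cnj (g k) * char_mod p (int l * (c * (int j - int k))))"
    by (rule sum.swap)
  also have "\<dots> = (\<Sum>j<p. \<Sum>k<p. \<Sum>l<p. f j * cnj (g k) * char_mod p (int l * (c * (int j - int k))))"
    by (intro sum.cong refl sum.swap)
  also have "\<dots> = (\<Sum>j<p. \<Sum>k<p. f j * cnj (g k) * (if j = k then of_nat p else 0))"
    by (intro sum.cong refl) (simp add: orth flip: sum_distrib_left)
  also have "\<dots> = of_nat p * (\<Sum>j<p. f j * cnj (g j))"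
    by (simp add: sum_distrib_left mult_ac if_distrib [of "\<lambda>x. _ * x"] cong: if_cong)
  finally show ?thesis .
qed

text \<open>
  Substitution rule behind both operators: translations and dilations are affine permutations of the
  residues, so sums of periodic functions do not see them.
\<close>

lemma sum_affine_mod:
  fixes F :: "int \<Rightarrow> 'a::comm_monoid_add"
  assumes "p > 0" "coprime c (int p)" and per: "\<And>x. F (x mod int p) = F x"
  shows "(\<Sum>k<p. F (c * int k + b)) = (\<Sum>k<p. F (int k))"
proof -
  define g where "g k = nat ((c * int k + b) mod int p)" for k
  have int_g: "int (g k) = (c * int k + b) mod int p" for k
    using assms(1) by (simp add: g_def)
  have "inj_on g {..<p}"
  proof
    fix j k assume jk: "j \<in> {..<p}" "k \<in> {..<p}" and "g j = g k"
    then have "[c * int j + b = c * int k + b] (mod int p)"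
      using int_g by (metis cong_def)
    then have "[int j = int k] (mod int p)"
      using assms(2) by (simp add: cong_add_rcancel cong_mult_lcancel)
    then show "j = k"
      using jk by (simp add: cong_int_iff cong_def)
  qed
  moreover have "g ` {..<p} \<subseteq> {..<p}"
    using assms(1) by (auto simp: g_def nat_less_iff)
  ultimately have "bij_betw g {..<p} {..<p}"
    by (simp add: bij_betw_def endo_inj_surj)
  then have "(\<Sum>k<p. F (int k)) = (\<Sum>k<p. F (int (g k)))"
    by (intro sum.reindex_bij_betw[symmetric])
  then show ?thesis
    by (simp add: int_g per)
qed

section \<open>The discrete Fourier transform\<close>

lemma dim_dft [simp]: "dim_vec (dft x) = dim_vec x"
  by (simp add: dft_def Let_def)

lemma at_res_mod [simp]: "at_res x (k mod int (dim_vec x)) = at_res x k"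
  by (simp add: at_res_def)

lemma at_res_of_nat: "k < dim_vec x \<Longrightarrow> at_res x (int k) = x $ k"
  by (simp add: at_res_def flip: of_nat_mod)

text \<open>
  The transform of a vector at an arbitrary integer frequency. Phrasing both the vector and its
  transform through \<^const>\<open>at_res\<close> makes every summand periodic, as the substitution rule demands.
\<close>

lemma at_res_dft:
  assumes "dim_vec x = p" "p > 0"
  shows "at_res (dft x) l =
    1 / of_real (sqrt (real p)) * (\<Sum>k<p. at_res x (int k) * char_mod p (- (l * int k)))"
proof -
  have *: "exp (- 2 * of_real pi * \<i> * of_nat (nat (l mod int p)) * of_nat k / of_nat p)
      = char_mod p (- (l * int k))" for k
  proof -
    have "exp (- 2 * of_real pi * \<i> * of_nat (nat (l mod int p)) * of_nat k / of_nat p)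
        = char_mod p (- ((l mod int p) * int k))"
      using assms(2) by (simp add: char_mod_def mult.assoc)
    also have "\<dots> = char_mod p (- (l * int k))"
      using char_mod_mult_mod[OF assms(2), of "int k" l] by (simp add: mult.commute)
    finally show ?thesis .
  qed
  have "nat (l mod int p) < p"
    using assms(2) by (simp add: nat_less_iff)
  then show ?thesis
    using assms unfolding at_res_def[of "dft x"]
    by (simp only: dim_dft, simp only: dft_def Let_def index_vec *) (simp add: at_res_of_nat)
qed

lemma dft_nth:
  assumes "dim_vec x = p" "l < p"
  shows "dft x $ l =
    1 / of_real (sqrt (real p)) * (\<Sum>k<p. at_res x (int k) * char_mod p (- (int l * int k)))"
  using at_res_dft[of x p "int l"] at_res_of_nat[of l "dft x"] assms by simp

lemma dft_parseval:
  assumes "dim_vec x = p" "dim_vec y = p" "p > 0"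
  shows "x \<bullet>c y = (\<Sum>l<p. dft x $ l * cnj (dft y $ l))"
proof -
  define s where "s = 1 / sqrt (real p)"
  define S where "S x l = (\<Sum>k<p. x $ k * char_mod p (-1 * int l * int k))" for x l
  have dft: "dft x $ l = of_real s * S x l" if "dim_vec x = p" "l < p" for x l
    using that dft_nth[of x p l] by (simp add: at_res_of_nat s_def S_def)
  have s: "s * s * real p = 1"
    using assms(3) by (simp add: s_def)
  have "(\<Sum>l<p. dft x $ l * cnj (dft y $ l)) = of_real (s * s) * (\<Sum>l<p. S x l * cnj (S y l))"
    unfolding sum_distrib_left using assms by (intro sum.cong refl) (simp add: dft mult_ac)
  also have "(\<Sum>l<p. S x l * cnj (S y l)) = of_real (real p) * (\<Sum>j<p. x $ j * cnj (y $ j))"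
    unfolding S_def of_real_of_nat_eq using assms(3) by (intro character_sum_plancherel) auto
  also have "of_real (s * s) * (of_real (real p) * (\<Sum>j<p. x $ j * cnj (y $ j))) = (\<Sum>j<p. x $ j * cnj (y $ j))"
    by (simp only: mult.assoc[symmetric] s of_real_1 mult_1_left flip: of_real_mult)
  also have "\<dots> = x \<bullet>c y"
    using assms by (simp add: scalar_prod_def atLeast0LessThan)
  finally show ?thesis ..
qed

lemma norm2_sq: "(norm2 x)\<^sup>2 = (\<Sum>k<dim_vec x. (cmod (x $ k))\<^sup>2)"
  by (simp add: norm2_def sum_nonneg)

lemma norm2_sq_dft:
  assumes "dim_vec x > 0"
  shows "(norm2 x)\<^sup>2 = (\<Sum>l<dim_vec x. (cmod (dft x $ l))\<^sup>2)"
proof -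
  have "complex_of_real ((norm2 x)\<^sup>2) = x \<bullet>c x"
    by (simp add: norm2_sq scalar_prod_def atLeast0LessThan complex_norm_square[symmetric]
        del: of_real_power)
  also have "\<dots> = of_real (\<Sum>l<dim_vec x. (cmod (dft x $ l))\<^sup>2)"
    using assms by (simp add: dft_parseval complex_norm_square[symmetric] del: of_real_power)
  finally show ?thesis
    by (simp only: of_real_eq_iff)
qed

section \<open>Wavelet systems\<close>

lemma dim_translation [simp]: "dim_vec (translation k x) = dim_vec x"
  by (simp add: translation_def)

lemma dim_dilation [simp]: "dim_vec (dilation m x) = dim_vec x"
  by (simp add: dilation_def)

lemma dim_wavelet [simp]: "dim_vec (wavelet y (m, k)) = dim_vec y"
  by (simp add: wavelet_def)

lemma at_res_translation:
  assumes "dim_vec x > 0"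
  shows "at_res (translation k x) s = at_res x (s - k)"
proof -
  have "at_res (translation k x) s = at_res x (s mod int (dim_vec x) - k)"
    using assms unfolding at_res_def[of "translation k x"]
    by (simp add: translation_def nat_less_iff)
  also have "\<dots> = at_res x (s - k)"
    by (simp add: at_res_def mod_simps)
  finally show ?thesis .
qed

lemma at_res_dilation:
  assumes "dim_vec x > 0"
  shows "at_res (dilation m x) s = at_res x (inv\<^bsub>Up (dim_vec x)\<^esub> m * s)"
proof -
  have "at_res (dilation m x) s = at_res x (inv\<^bsub>Up (dim_vec x)\<^esub> m * (s mod int (dim_vec x)))"
    using assms unfolding at_res_def[of "dilation m x"]
    by (simp add: dilation_def nat_less_iff)
  also have "\<dots> = at_res x (inv\<^bsub>Up (dim_vec x)\<^esub> m * s)"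
    by (simp add: at_res_def mod_simps)
  finally show ?thesis .
qed

text \<open>
  Substituting \<open>s + k\<close> for \<open>s\<close> pulls a character value out of the sum.
\<close>

lemma dft_translation:
  assumes "dim_vec x = p" "p > 0"
  shows "at_res (dft (translation k x)) l = char_mod p (- (l * k)) * at_res (dft x) l"
proof -
  define F where "F s = at_res x (s - k) * char_mod p (- (l * s))" for s
  have "F (s mod int p) = F s" for s
  proof -
    have "at_res x (s mod int p - k) = at_res x (s - k)"
      using assms(1) by (simp add: at_res_def mod_simps)
    moreover have "char_mod p (- (l * (s mod int p))) = char_mod p (- (l * s))"
      by (rule char_mod_mult_mod[OF assms(2)])
    ultimately show ?thesis by (simp add: F_def)
  qed
  then have "(\<Sum>s<p. F (int s)) = (\<Sum>s<p. F (1 * int s + k))"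
    using assms(2) by (intro sum_affine_mod[symmetric]) auto
  also have "\<dots> = char_mod p (- (l * k)) * (\<Sum>s<p. at_res x (int s) * char_mod p (- (l * int s)))"
    using char_mod_add[of p "- (l * k)"]
    by (simp add: F_def sum_distrib_left ring_distribs mult.commute mult.left_commute)
  finally show ?thesis
    using assms by (simp add: at_res_dft at_res_translation F_def)
qed

lemma Up_carrier: "prime p \<Longrightarrow> carrier (Up p) = {1..int p - 1}"
  using residues_prime.res_prime_units_eq[of p] prime_gt_0_nat[of p]
  by (auto simp: residues_prime_def units_of_carrier of_nat_diff)

lemma Up_mult: "x \<otimes>\<^bsub>Up p\<^esub> y = x * y mod int p"
  by (simp add: units_of_def residue_ring_def)

lemma Up_one: "\<one>\<^bsub>Up p\<^esub> = 1"
  by (simp add: units_of_def residue_ring_def)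

lemma Up_group:
  assumes "prime p"
  shows "group (Up p)"
proof -
  interpret residues_prime p "Zp p" by unfold_locales fact
  show ?thesis by (rule units_group)
qed

lemma Up_pow:
  assumes "prime p"
  shows "x [^]\<^bsub>Up p\<^esub> (n::nat) = x ^ n mod int p"
proof (induction n)
  case 0
  then show ?case
    using prime_gt_1_nat[OF assms] by (simp add: Up_one)
next
  case (Suc n)
  then show ?case
    by (simp add: Up_mult mod_simps mult.commute)
qed

lemma Up_coprime:
  assumes "prime p" "x \<in> carrier (Up p)"
  shows "coprime x (int p)"
proof -
  interpret residues_prime p "Zp p" by unfold_locales fact
  show ?thesis
    using assms(2) by (simp add: units_of_carrier res_units_eq)
qed

lemma Up_inverse_cong:
  assumes "prime p" "m \<in> carrier (Up p)"
  shows "[m * inv\<^bsub>Up p\<^esub> m = 1] (mod int p)"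
proof -
  interpret group "Up p" using assms(1) by (rule Up_group)
  have "m * inv\<^bsub>Up p\<^esub> m mod int p = 1"
    using r_inv[OF assms(2)] by (simp add: Up_mult Up_one)
  then show ?thesis
    using prime_gt_1_nat[OF assms(1)] by (simp add: cong_def)
qed

text \<open>
  The substitution \<open>s \<mapsto> m * s\<close> cancels the inverse of \<open>m\<close> in the dilation. The weight \<open>G\<close> is a
  character for the Fourier transform and trivial for the norm.
\<close>

lemma sum_dilate:
  assumes "prime p" "m \<in> carrier (Up p)" "dim_vec x = p"
    and G: "\<And>s. G (s mod int p) = G s"
  shows "(\<Sum>s<p. H (at_res (dilation m x) (int s)) (G (int s)))
       = (\<Sum>s<p. H (at_res x (int s)) (G (m * int s)))"
proof -
  define F where "F s = H (at_res (dilation m x) s) (G s)" for s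
  have p: "p > 0" using assms(1) by (rule prime_gt_0_nat)
  have "F (s mod int p) = F s" for s
    using at_res_mod[of "dilation m x" s] assms(3) G by (simp add: F_def)
  then have "(\<Sum>s<p. F (int s)) = (\<Sum>s<p. F (m * int s + 0))"
    using p Up_coprime[OF assms(1,2)] by (intro sum_affine_mod[symmetric])
  moreover have "at_res (dilation m x) (m * int s) = at_res x (int s)" for s
  proof -
    have "[inv\<^bsub>Up p\<^esub> m * (m * int s) = 1 * int s] (mod int p)"
      using cong_scalar_right[OF Up_inverse_cong[OF assms(1,2)], of "int s"] by (simp add: mult_ac)
    then have "at_res x (inv\<^bsub>Up p\<^esub> m * (m * int s)) = at_res x (int s)"
      using assms(3) by (simp add: at_res_def cong_def)
    then show ?thesis
      using p assms(3) by (simp add: at_res_dilation)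
  qed
  ultimately show ?thesis
    by (simp add: F_def)
qed

lemma dft_dilation:
  assumes "prime p" "m \<in> carrier (Up p)" "dim_vec x = p"
  shows "at_res (dft (dilation m x)) l = at_res (dft x) (m * l)"
proof -
  have p: "p > 0" using assms(1) by (rule prime_gt_0_nat)
  have "char_mod p (- (l * (s mod int p))) = char_mod p (- (l * s))" for s
    using p by (rule char_mod_mult_mod)
  then have "(\<Sum>s<p. at_res (dilation m x) (int s) * char_mod p (- (l * int s)))
      = (\<Sum>s<p. at_res x (int s) * char_mod p (- (l * (m * int s))))"
    using sum_dilate[OF assms, where H = "(*)" and G = "\<lambda>s. char_mod p (- (l * s))"] by simp
  then show ?thesis
    using p assms(3) by (simp add: at_res_dft mult_ac)
qed

lemma dft_wavelet:
  assumes "prime p" "m \<in> carrier (Up p)" "dim_vec y = p" "l < p"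
  shows "dft (wavelet y (m, k)) $ l = char_mod p (- (int l * k)) * at_res (dft y) (m * int l)"
proof -
  have p: "p > 0" using assms(1) by (rule prime_gt_0_nat)
  show ?thesis
    using at_res_of_nat[of l "dft (wavelet y (m, k))"] assms p
    by (simp add: wavelet_def dft_translation dft_dilation)
qed

lemma norm2_sq_at_res: "(norm2 x)\<^sup>2 = (\<Sum>k<dim_vec x. (cmod (at_res x (int k)))\<^sup>2)"
  by (simp add: norm2_sq at_res_of_nat)

lemma norm2_wavelet:
  assumes "prime p" "m \<in> carrier (Up p)" "dim_vec y = p"
  shows "norm2 (wavelet y (m, k)) = norm2 y"
proof -
  have p: "p > 0" using assms(1) by (rule prime_gt_0_nat)
  let ?F = "\<lambda>s. (cmod (at_res (dilation m y) s))\<^sup>2"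
  have "(norm2 (wavelet y (m, k)))\<^sup>2 = (\<Sum>s<p. ?F (1 * int s + - k))"
    using assms p by (simp add: norm2_sq_at_res wavelet_def at_res_translation)
  also have "\<dots> = (\<Sum>s<p. ?F (int s))"
    using p at_res_mod[of "dilation m y"] assms(3) by (intro sum_affine_mod) auto
  also have "\<dots> = (norm2 y)\<^sup>2"
    using sum_dilate[OF assms, where H = "\<lambda>z _. (cmod z)\<^sup>2" and G = "\<lambda>_. ()"] assms(3)
    by (simp add: norm2_sq_at_res)
  finally show ?thesis
    by (simp add: norm2_def sum_nonneg)
qed

text \<open>
  For fixed \<open>m\<close> the inner products with all translates form a character sum in \<open>k\<close>, with
  coefficients \<open>dft x $ l\<close> times the conjugate of the dilated transform of \<open>y\<close>. Plancherel's
  identity removes the characters.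
\<close>

lemma sum_norm_inner_translates:
  assumes "prime p" "m \<in> carrier (Up p)" "dim_vec x = p" "dim_vec y = p"
  shows "(\<Sum>k\<in>carrier (Zp p). (cmod (x \<bullet>c wavelet y (m, k)))\<^sup>2)
       = real p * (\<Sum>l<p. (cmod (dft x $ l))\<^sup>2 * (cmod (at_res (dft y) (m * int l)))\<^sup>2)"
proof -
  have p: "p > 0" using assms(1) by (rule prime_gt_0_nat)
  define f where "f l = dft x $ l * cnj (at_res (dft y) (m * int l))" for l
  have inner: "x \<bullet>c wavelet y (m, int k) = (\<Sum>l<p. f l * char_mod p (1 * int k * int l))" for k
    using assms p by (simp add: dft_parseval[of x p] dft_wavelet f_def cnj_char_mod mult_ac)
  have "bij_betw int {..<p} (carrier (Zp p))"
    using image_int_atLeastLessThan[of 0 p]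
    by (auto simp: residue_ring_def bij_betw_def atLeast0LessThan)
  then have "(\<Sum>k\<in>carrier (Zp p). (cmod (x \<bullet>c wavelet y (m, k)))\<^sup>2)
      = (\<Sum>k<p. (cmod (x \<bullet>c wavelet y (m, int k)))\<^sup>2)"
    by (intro sum.reindex_bij_betw[symmetric])
  moreover have "complex_of_real (\<Sum>k<p. (cmod (x \<bullet>c wavelet y (m, int k)))\<^sup>2)
      = of_real (real p * (\<Sum>l<p. (cmod (f l))\<^sup>2))"
  proof -
    have "complex_of_real (\<Sum>k<p. (cmod (x \<bullet>c wavelet y (m, int k)))\<^sup>2)
        = (\<Sum>k<p. x \<bullet>c wavelet y (m, int k) * cnj (x \<bullet>c wavelet y (m, int k)))"
      by (simp add: complex_norm_square[symmetric] del: of_real_power)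
    also have "\<dots> = of_nat p * (\<Sum>l<p. f l * cnj (f l))"
      unfolding inner using p by (intro character_sum_plancherel) auto
    also have "\<dots> = of_real (real p * (\<Sum>l<p. (cmod (f l))\<^sup>2))"
      by (simp add: complex_norm_square[symmetric] del: of_real_power)
    finally show ?thesis .
  qed
  ultimately have "(\<Sum>k\<in>carrier (Zp p). (cmod (x \<bullet>c wavelet y (m, k)))\<^sup>2)
      = real p * (\<Sum>l<p. (cmod (f l))\<^sup>2)"
    by (simp only: of_real_eq_iff)
  then show ?thesis
    by (simp add: f_def norm_mult power_mult_distrib)
qed

text \<open>
  The discrete Calderon condition: summing the previous identity over the dilations leaves
  \<open>|dft x $ l|\<^sup>2\<close> with a weight that depends on \<open>l\<close> alone, and the assumption says that this
  weight is 1.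
\<close>

lemma parseval_frame_waveletI:
  assumes "prime p" "A \<subseteq> carrier (Up p)" "y \<in> carrier_vec p"
    and calderon: "\<And>l. l < p \<Longrightarrow> real p * (\<Sum>m\<in>A. (cmod (at_res (dft y) (m * int l)))\<^sup>2) = 1"
  shows "parseval_frame p (A \<times> carrier (Zp p)) (wavelet y)"
  unfolding parseval_frame_def
proof (intro conjI ballI)
  have p: "p > 0" using assms(1) by (rule prime_gt_0_nat)
  have finA: "finite A"
    using finite_subset[OF assms(2)] Up_carrier[OF assms(1)] by simp
  have finZ: "finite (carrier (Zp p))"
    by (simp add: residue_ring_def)
  show "finite (A \<times> carrier (Zp p))"
    using finA finZ by simp
  show "wavelet y j \<in> carrier_vec p" if "j \<in> A \<times> carrier (Zp p)" for j
    using assms(3) by (cases j) (simp only: carrier_dim_vec dim_wavelet)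
  fix x :: "complex vec"
  assume x: "x \<in> carrier_vec p"
  have "(\<Sum>j\<in>A \<times> carrier (Zp p). (cmod (x \<bullet>c wavelet y j))\<^sup>2)
      = (\<Sum>m\<in>A. \<Sum>k\<in>carrier (Zp p). (cmod (x \<bullet>c wavelet y (m, k)))\<^sup>2)"
    by (simp add: sum.cartesian_product)
  also have "\<dots> = (\<Sum>m\<in>A. real p * (\<Sum>l<p. (cmod (dft x $ l))\<^sup>2 * (cmod (at_res (dft y) (m * int l)))\<^sup>2))"
    using x assms(3) by (intro sum.cong refl sum_norm_inner_translates subsetD[OF assms(2)] assms(1))
      (simp_all only: carrier_dim_vec)
  also have "\<dots> = (\<Sum>m\<in>A. \<Sum>l<p. (cmod (dft x $ l))\<^sup>2 * (real p * (cmod (at_res (dft y) (m * int l)))\<^sup>2))"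
    by (simp add: sum_distrib_left mult.left_commute)
  also have "\<dots> = (\<Sum>l<p. \<Sum>m\<in>A. (cmod (dft x $ l))\<^sup>2 * (real p * (cmod (at_res (dft y) (m * int l)))\<^sup>2))"
    by (rule sum.swap)
  also have "\<dots> = (\<Sum>l<p. (cmod (dft x $ l))\<^sup>2)"
  proof (intro sum.cong refl)
    fix l assume "l \<in> {..<p}"
    have "(\<Sum>m\<in>A. (cmod (dft x $ l))\<^sup>2 * (real p * (cmod (at_res (dft y) (m * int l)))\<^sup>2))
        = (cmod (dft x $ l))\<^sup>2 * (real p * (\<Sum>m\<in>A. (cmod (at_res (dft y) (m * int l)))\<^sup>2))"
      by (simp only: sum_distrib_left)
    then show "(\<Sum>m\<in>A. (cmod (dft x $ l))\<^sup>2 * (real p * (cmod (at_res (dft y) (m * int l)))\<^sup>2))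
        = (cmod (dft x $ l))\<^sup>2"
      using calderon \<open>l \<in> {..<p}\<close> by simp
  qed
  also have "\<dots> = (norm2 x)\<^sup>2"
    using x p by (simp add: norm2_sq_dft)
  finally show "(\<Sum>j\<in>A \<times> carrier (Zp p). (cmod (x \<bullet>c wavelet y j))\<^sup>2) = (norm2 x)\<^sup>2" .
qed

section \<open>Cosets in a cyclic group\<close>

lemma (in group) pow_mod_ord:
  assumes "x \<in> carrier G"
  shows "x [^] (n mod ord x) = x [^] (n::nat)"
proof -
  have "x [^] n = x [^] (ord x * (n div ord x) + n mod ord x)"
    by simp
  also have "\<dots> = (x [^] ord x) [^] (n div ord x) \<otimes> x [^] (n mod ord x)"
    using assms by (simp only: nat_pow_mult nat_pow_pow)
  also have "\<dots> = x [^] (n mod ord x)"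
    using assms by simp
  finally show ?thesis ..
qed

lemma (in group) subgroup_pow_card:
  assumes "subgroup H G" "x \<in> H"
  shows "x [^] card H = \<one>"
proof -
  interpret H: group "G\<lparr>carrier := H\<rparr>"
    using assms(1) by (rule subgroup_imp_group)
  have "x [^]\<^bsub>G\<lparr>carrier := H\<rparr>\<^esub> card H = \<one>"
    using H.pow_order_eq_1[of x] assms(2) by (simp add: order_def)
  then show ?thesis
    using nat_pow_consistent[of x "card H" H] by simp
qed

text \<open>
  The coset of \<open>e [^] n\<close> consists of the powers of \<open>e\<close> whose exponent is congruent to \<open>n\<close> modulo
  the index \<open>a\<close>: an element \<open>e [^] k\<close> of \<open>H\<close> is killed by \<open>M\<close>, so \<open>a * M\<close> divides \<open>k * M\<close> and
  \<open>a\<close> divides \<open>k\<close>. This is one inclusion; the other holds because both sets have \<open>M\<close> elements.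
\<close>

lemma (in group) sum_coset_cyclic:
  fixes n :: nat
  assumes e: "e \<in> carrier G" "ord e = a * M" and pos: "a > 0" "M > 0"
    and H: "subgroup H G" "card H = M"
    and gen: "\<And>m. m \<in> H \<Longrightarrow> \<exists>k::nat. m = e [^] k"
  shows "(\<Sum>m\<in>H. F (m \<otimes> e [^] n)) = (\<Sum>r<M. F (e [^] (r * a + n mod a)))"
proof -
  define A where "A = (\<lambda>m. m \<otimes> e [^] n) ` H"
  define B where "B = (\<lambda>r. e [^] (r * a + n mod a)) ` {..<M}"
  have Hsub: "H \<subseteq> carrier G"
    using H(1) by (rule subgroup.subset)
  have "A \<subseteq> B"
  proof
    fix x assume "x \<in> A"
    then obtain m where m: "m \<in> H" "x = m \<otimes> e [^] n"
      by (auto simp: A_def)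
    then obtain k :: nat where k: "m = e [^] k"
      using gen by blast
    have "e [^] (k * M) = \<one>"
      using subgroup_pow_card[OF H(1) m(1)] H(2) e(1) k by (simp add: nat_pow_pow)
    then have "a dvd k"
      using e pos by (simp add: pow_eq_id)
    then have t: "(k + n) mod a = n mod a"
      by (auto elim!: dvdE)
    define r where "r = (k + n) div a mod M"
    have "(k + n) mod (a * M) = r * a + n mod a"
      using mod_mult2_eq[of "k + n" a M] by (simp add: r_def t mult.commute[of a])
    then have "x = e [^] (r * a + n mod a)"
      using pow_mod_ord[OF e(1), of "k + n"] m(2) k e by (simp add: nat_pow_mult)
    moreover have "r < M"
      using pos by (simp add: r_def)
    ultimately show "x \<in> B"
      by (auto simp: B_def)
  qed
  have injA: "inj_on (\<lambda>m. m \<otimes> e [^] n) H"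
    using Hsub e(1) by (auto intro!: inj_onI simp: subset_iff)
  have injB: "inj_on (\<lambda>r. e [^] (r * a + n mod a)) {..<M}"
  proof
    fix r s
    assume rs: "r \<in> {..<M}" "s \<in> {..<M}" "e [^] (r * a + n mod a) = e [^] (s * a + n mod a)"
    \<comment> \<open>The exponents stay below the order of \<open>e\<close>, where taking powers is injective.\<close>
    have "q * a + n mod a \<le> a * M - 1" if "q < M" for q
    proof -
      have "q * a + n mod a < q * a + a"
        using pos by simp
      also have "\<dots> = Suc q * a"
        by simp
      also have "\<dots> \<le> M * a"
        using that by (intro mult_right_mono) auto
      finally show ?thesis
        by (simp add: mult.commute)
    qed
    then have "r * a + n mod a = s * a + n mod a"
      using rs e by (intro inj_onD[OF ord_inj[OF e(1)] rs(3)]) auto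
    then show "r = s"
      using pos by simp
  qed
  have "card A = card B"
    unfolding A_def B_def card_image[OF injA] card_image[OF injB] using H by simp
  then have "A = B"
    using \<open>A \<subseteq> B\<close> by (intro card_subset_eq) (auto simp: B_def)
  have "(\<Sum>m\<in>H. F (m \<otimes> e [^] n)) = sum F A"
    unfolding A_def by (simp add: sum.reindex[OF injA])
  also have "\<dots> = (\<Sum>r<M. F (e [^] (r * a + n mod a)))"
    unfolding \<open>A = B\<close> B_def by (simp add: sum.reindex[OF injB])
  finally show ?thesis .
qed

text \<open>
  The translation of the group-theoretic statement into residues and integer powers. The same \<open>t\<close>
  must serve for all \<open>F\<close>, because it names the coset of \<open>x\<close>.
\<close>

lemma coset_decomposition_Up:
  assumes p: "prime p"
    and gen: "e \<in> carrier (Up p)" "generate (Up p) {e} = carrier (Up p)"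
    and H: "subgroup H (Up p)"
  defines "M \<equiv> card H"
  defines "a \<equiv> (p - 1) div M"
  shows "M > 0" "a * M = p - 1"
    and "\<And>x. x \<in> carrier (Up p) \<Longrightarrow>
      \<exists>t<a. \<forall>F. (\<Sum>m\<in>H. F (m * x mod int p)) = (\<Sum>r<M. F (e ^ (r * a + t) mod int p) :: real)"
proof -
  interpret group "Up p" using p by (rule Up_group)
  have fin: "finite (carrier (Up p))" and card: "card (carrier (Up p)) = p - 1"
    using Up_carrier[OF p] by auto
  have "M dvd p - 1"
    using lagrange[OF H] card by (simp add: order_def M_def) (metis dvd_triv_right)
  then show aM: "a * M = p - 1"
    by (simp add: a_def)
  moreover have "p > 1" using p by (rule prime_gt_1_nat)
  ultimately have pos: "a > 0" "M > 0"
    by (auto intro: gr0I)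
  then show "M > 0" by simp
  have ord: "ord e = a * M"
    using generate_pow_card[OF gen(1)] gen(2) card aM by simp
  have pow: "\<exists>k::nat. x = e [^]\<^bsub>Up p\<^esub> k" if "x \<in> carrier (Up p)" for x
    using that generate_pow_on_finite_carrier[OF fin gen(1)] gen(2) by auto
  fix x assume "x \<in> carrier (Up p)"
  then obtain n :: nat where n: "x = e [^]\<^bsub>Up p\<^esub> n"
    using pow by blast
  have "(\<Sum>m\<in>H. F (m * x mod int p)) = (\<Sum>r<M. F (e ^ (r * a + n mod a) mod int p))"
    for F :: "int \<Rightarrow> real"
    using sum_coset_cyclic[OF gen(1) ord pos H, of F n] pow subgroup.subset[OF H]
    by (auto simp: Up_mult Up_pow[OF p] n M_def subset_iff)
  then show "\<exists>t<a. \<forall>F. (\<Sum>m\<in>H. F (m * x mod int p)) = (\<Sum>r<M. F (e ^ (r * a + t) mod int p) :: real)"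
    using pos by (intro exI[of _ "n mod a"]) auto
qed

section \<open>The modified generator\<close>

lemma diag_block_mat_scalar_blocks:
  fixes cs :: "'a::comm_ring_1 list"
  shows "diag_block_mat (map (\<lambda>c. c \<cdot>\<^sub>m 1\<^sub>m M) cs) =
    mat (length cs * M) (length cs * M) (\<lambda>(i, j). if i = j then cs ! (i div M) else 0)"
proof (induction cs)
  case Nil
  then show ?case by (intro eq_matI) auto
next
  case (Cons c cs)
  have "i div M = Suc ((i - M) div M)" if "\<not> i < M" "i < M + length cs * M" for i
    using that by (metis div_if gr0I linorder_not_less mult_0_right add_0 not_less_zero)
  then show ?case
    unfolding list.map diag_block_mat.simps Let_def Cons.IH
    by (intro eq_matI) auto
qed

text \<open>
  Index \<open>Suc (t * M + r)\<close> is position \<open>r\<close> of the block with number \<open>t\<close>: the successor skips the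
  leading block of size 1.
\<close>

lemma D_mat_mult:
  assumes "v \<in> carrier_vec (Suc (a * M))"
  shows "(D_mat p e M a y *\<^sub>v v) $ 0 = of_real (R_zero p M y) * v $ 0"
    and "\<And>t r. t < a \<Longrightarrow> r < M \<Longrightarrow>
      (D_mat p e M a y *\<^sub>v v) $ (Suc (t * M + r)) = of_real (R_coset p e M a y t) * v $ (Suc (t * M + r))"
proof -
  \<comment> \<open>\<open>c i\<close> is the \<open>i\<close>-th diagonal entry.\<close>
  define c where "c i = complex_of_real (if i = 0 then R_zero p M y
    else R_coset p e M a y ((i - 1) div M))" for i
  let ?n = "Suc (a * M)"
  define blocks where "blocks = map (\<lambda>t. complex_of_real (R_coset p e M a y t)) [0..<a]"
  have D: "D_mat p e M a y = mat ?n ?n (\<lambda>(i, j). if i = j then c i else 0)"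
  proof -
    have "D_mat p e M a y = diag_block_mat (complex_of_real (R_zero p M y) \<cdot>\<^sub>m 1\<^sub>m 1 # map (\<lambda>c. c \<cdot>\<^sub>m 1\<^sub>m M) blocks)"
      by (simp add: D_mat_def blocks_def comp_def)
    also have "\<dots> = mat ?n ?n (\<lambda>(i, j). if i = j then c i else 0)"
    proof -
      have nth: "blocks ! ((i - Suc 0) div M) = c i" if "i < ?n" "i \<noteq> 0" for i
      proof -
        have "(i - 1) div M < a"
          using that by (intro less_mult_imp_div_less) auto
        then show ?thesis
          using that by (simp add: c_def blocks_def)
      qed
      show ?thesis
        unfolding diag_block_mat.simps Let_def diag_block_mat_scalar_blocks
        by (intro eq_matI) (auto simp: nth blocks_def[THEN arg_cong[where f = length]] c_def[of 0])
    qed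
    finally show ?thesis .
  qed
  have entry: "(D_mat p e M a y *\<^sub>v v) $ i = c i * v $ i" if "i < ?n" for i
  proof -
    have "(D_mat p e M a y *\<^sub>v v) $ i = (\<Sum>j = 0..<?n. (if i = j then c i else 0) * v $ j)"
      using that assms by (simp add: D scalar_prod_def del: sum.op_ivl_Suc)
    also have "\<dots> = (\<Sum>j = 0..<?n. if i = j then c i * v $ j else 0)"
      by (intro sum.cong) auto
    also have "\<dots> = c i * v $ i"
      using that by simp
    finally show ?thesis .
  qed
  show "(D_mat p e M a y *\<^sub>v v) $ 0 = of_real (R_zero p M y) * v $ 0"
    by (simp add: entry c_def)
  fix t r assume tr: "t < a" "r < M"
  have "t * M + r < a * M"
    using mult_right_mono[of "Suc t" a M] tr by simp
  then show "(D_mat p e M a y *\<^sub>v v) $ (Suc (t * M + r)) = of_real (R_coset p e M a y t) * v $ (Suc (t * M + r))"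
    using tr by (simp add: entry c_def)
qed

text \<open>
  In the same coordinates \<open>\<sigma>\<close> sends block \<open>t\<close> to the coset of \<open>e ^ t\<close>, which is why the block matrix
  acts on each coset by one scalar.
\<close>

lemma sigma_perm_Suc:
  assumes "r < M"
  shows "sigma_perm p e M a (Suc (t * M + r)) = nat (e ^ (r * a + t) mod int p)"
  using assms by (simp add: sigma_perm_def add.commute)

theorem theorem4p2:
  fixes p M a :: nat and \<epsilon> :: int and H :: "int set"
    and y yh' yh'' y\<^sub>\<sigma> :: "complex vec" and \<sigma> :: "nat \<Rightarrow> nat"
  assumes p: "prime p"
    and gen: "\<epsilon> \<in> carrier (Up p)" "generate (Up p) {\<epsilon>} = carrier (Up p)"
    and H: "subgroup H (Up p)" "card H = M"
    and a: "a = (p - 1) div M"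
    and \<sigma>: "\<sigma> = sigma_perm p \<epsilon> M a"
    and y: "y \<in> carrier_vec p" "y \<noteq> 0\<^sub>v p"
    and i: "dft y $ 0 \<noteq> 0"
    and ii: "\<forall>t<a. \<exists>r<M. at_res (dft y) (\<epsilon> ^ (r * a + t)) \<noteq> 0"
    and yh': "yh' = vec p (\<lambda>l. dft y $ \<sigma> l)"
    and yh'': "yh'' = D_mat p \<epsilon> M a y *\<^sub>v yh'"
    and y\<^sub>\<sigma>: "y\<^sub>\<sigma> \<in> carrier_vec p" "\<forall>l<p. dft y\<^sub>\<sigma> $ \<sigma> l = yh'' $ l"
  shows "parseval_frame p (H \<times> carrier (Zp p)) (wavelet y\<^sub>\<sigma>)
       \<and> equal_norm (H \<times> carrier (Zp p)) (wavelet y\<^sub>\<sigma>)"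
proof -
  have p0: "p > 0" using p by (rule prime_gt_0_nat)
  note M = H(2)[symmetric]
  note a' = a[unfolded M]
  note cosets = coset_decomposition_Up[OF p gen H(1), folded a', unfolded H(2)]
  have Mpos: "M > 0" and aM: "a * M = p - 1"
    using cosets(1,2) .
  have p_eq: "p = Suc (a * M)"
    using aM p0 by simp
  have dim: "dim_vec y = p" "dim_vec y\<^sub>\<sigma> = p" "yh' \<in> carrier_vec (Suc (a * M))"
    using y(1) y\<^sub>\<sigma>(1) p_eq by (auto simp: yh')
  have zero: "dft y\<^sub>\<sigma> $ 0 = of_real (R_zero p M y) * dft y $ 0"
    using y\<^sub>\<sigma>(2) p0 D_mat_mult(1)[OF dim(3), of p \<epsilon> y]
    by (auto simp: yh'' yh' \<sigma> sigma_perm_def)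
  have coset: "at_res (dft y\<^sub>\<sigma>) (\<epsilon> ^ (r * a + t))
      = of_real (R_coset p \<epsilon> M a y t) * at_res (dft y) (\<epsilon> ^ (r * a + t))"
    if "t < a" "r < M" for t r
  proof -
    have "t * M + r < a * M"
      using mult_right_mono[of "Suc t" a M] that by simp
    then have l: "Suc (t * M + r) < p"
      by (simp add: p_eq)
    have at: "at_res (dft z) (\<epsilon> ^ (r * a + t)) = dft z $ \<sigma> (Suc (t * M + r))"
      if "dim_vec z = p" for z
      using that sigma_perm_Suc[OF \<open>r < M\<close>] by (simp add: at_res_def \<sigma>)
    have "dft y\<^sub>\<sigma> $ \<sigma> (Suc (t * M + r)) = of_real (R_coset p \<epsilon> M a y t) * yh' $ Suc (t * M + r)"
      using y\<^sub>\<sigma>(2) l D_mat_mult(2)[OF dim(3) that, of p \<epsilon> y] by (simp add: yh'')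
    then show ?thesis
      using l dim by (simp add: at yh')
  qed
  have calderon: "real p * (\<Sum>m\<in>H. (cmod (at_res (dft y\<^sub>\<sigma>) (m * int l)))\<^sup>2) = 1" if "l < p" for l
  proof (cases "l = 0")
    case True
    have "at_res (dft y\<^sub>\<sigma>) 0 = of_real (R_zero p M y) * dft y $ 0"
      using zero by (simp add: at_res_def)
    then have "(cmod (at_res (dft y\<^sub>\<sigma>) 0))\<^sup>2 = 1 / (real p * real M)"
      using i by (simp add: R_zero_def norm_mult norm_divide power_mult_distrib power_divide)
    then show ?thesis
      using True p0 Mpos by (simp add: H(2))
  next
    case False
    then have "int l \<in> carrier (Up p)"
      using that by (simp add: Up_carrier[OF p])
    from cosets(3)[OF this] obtain t where t: "t < a"
      "\<And>F. (\<Sum>m\<in>H. F (m * int l mod int p)) = (\<Sum>r<M. F (\<epsilon> ^ (r * a + t) mod int p) :: real)"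
      by blast
    define S where "S = (\<Sum>r<M. real p * (cmod (at_res (dft y) (\<epsilon> ^ (r * a + t))))\<^sup>2)"
    have "S > 0"
    proof -
      obtain r where "r < M" "at_res (dft y) (\<epsilon> ^ (r * a + t)) \<noteq> 0"
        using ii t(1) by blast
      then show ?thesis
        unfolding S_def using p0 by (intro sum_pos2[of _ r]) auto
    qed
    have mod: "at_res (dft y\<^sub>\<sigma>) (k mod int p) = at_res (dft y\<^sub>\<sigma>) k" for k
      using at_res_mod[of "dft y\<^sub>\<sigma>" k] dim by simp
    have "(\<Sum>m\<in>H. (cmod (at_res (dft y\<^sub>\<sigma>) (m * int l)))\<^sup>2)
        = (\<Sum>r<M. (cmod (at_res (dft y\<^sub>\<sigma>) (\<epsilon> ^ (r * a + t))))\<^sup>2)"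
      using t(2)[of "\<lambda>k. (cmod (at_res (dft y\<^sub>\<sigma>) k))\<^sup>2"] by (simp add: mod)
    then have "real p * (\<Sum>m\<in>H. (cmod (at_res (dft y\<^sub>\<sigma>) (m * int l)))\<^sup>2)
        = (R_coset p \<epsilon> M a y t)\<^sup>2 * S"
      using t(1) by (simp add: coset norm_mult power_mult_distrib S_def sum_distrib_left mult_ac)
    also have "\<dots> = 1"
      using \<open>S > 0\<close> by (simp add: R_coset_def flip: S_def add: power_divide)
    finally show ?thesis .
  qed
  have Hsub: "H \<subseteq> carrier (Up p)"
    using H(1) by (rule subgroup.subset)
  show ?thesis
  proof
    show "parseval_frame p (H \<times> carrier (Zp p)) (wavelet y\<^sub>\<sigma>)"
      using p Hsub y\<^sub>\<sigma>(1) calderon by (rule parseval_frame_waveletI)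
    show "equal_norm (H \<times> carrier (Zp p)) (wavelet y\<^sub>\<sigma>)"
      using Hsub p dim(2) by (auto simp: equal_norm_def norm2_wavelet subset_iff)
  qed
qed

end
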